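(* Let $\mu \ge 0$ and let $f\colon\mathbb{R}^d\to\mathbb{R}$ be a differentiable $\mu$-strongly convex function. Consider the additional assumptions: (L) $f$ is $L$-smooth; (SC) $\mu>0$. Then each of the following maps $\overline{\nabla} f\colon \mathbb{R}^d\times\mathbb{R}^d\to\mathbb{R}^d$ is a weak discrete gradient of $f$ with the indicated parameters $(\alpha,\beta,\gamma)$: (i) If $\overline{\nabla} f(y,x)=\nabla f(x)$ and $f$ satisfies (L), then $(\alpha,\beta,\gamma)=\left(\frac{L}{2},\frac{\mu}{2},0\right)$. (ii) If $\overline{\nabla} f(y,x)=\nabla f(y)$, then $(\alpha,\beta,\gamma)=\left(0,0,\frac{\mu}{2}\right)$. (iii) If $\overline{\nabla} f(y,x)=\nabla f\left(\frac{x+y}{2}\right)$ and $f$ satisfies (L), then $(\alpha,\beta,\gamma)=\left(\frac{L+\mu}{8},\frac{\mu}{4},\frac{\mu}{4}\right)$. (iv) If $\overline{\nabla} f(y,x)=\nabla_{\mathrm{AVF}} f(y,x)$ and $f$ satisfies (L), then $(\alpha,\beta,\gamma)=\left(\frac{L}{6}+\frac{\mu}{12},\frac{\mu}{4},\frac{\mu}{4}\right)$. (v) If $\overline{\nabla} f(y,x)=\nabla_{\mathrm{G}} f(y,x)$ and $f$ satisfies (L) and (SC), then $(\alpha,\beta,\gamma)=\left(\frac{L+\mu}{8}+\frac{(L-\mu)^2}{16\mu},\frac{\mu}{4},0\right)$. (vi) If $\overline{\nabla} f(y,x)=\nabla_{\mathrm{IA}} f(y,x)$ and $f$ satisfies (L)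 and (SC), then $(\alpha,\beta,\gamma)=\left(\frac{dL^2}{\mu}-\frac{\mu}{4},\frac{\mu}{2},-\frac{\mu}{4}\right)$.
   Context: $\mathbb{R}^d$ carries the standard inner product $\langle\cdot,\cdot\rangle$ and Euclidean norm $\|\cdot\|$. Standing assumption: $f$ is differentiable and attains its minimum. $f$ is $L$-smooth if $\nabla f$ is $L$-Lipschitz continuous. $f$ is $\mu$-strongly convex ($\mu\ge 0$; $\mu=0$ means convex) if $f-\frac{\mu}{2}\|\cdot\|^2$ is convex. Weak discrete gradient: a map $\overline{\nabla} f\colon\mathbb{R}^d\times\mathbb{R}^d\to\mathbb{R}^d$ is a weak discrete gradient of $f$ with parameters $(\alpha,\beta,\gamma)$, where $\alpha\ge 0$ and $\beta+\gamma\ge 0$ are real numbers, if for all $x,y,z\in\mathbb{R}^d$ $$f(y)-f(x)\le\langle\overline{\nabla} f(y,z),y-x\rangle+\alpha\|y-z\|^2-\beta\|z-x\|^2-\gamma\|y-x\|^2$$ and $\overline{\nabla} f(x,x)=\nabla f(x)$. Specific maps: - Average vector field: $\nabla_{\mathrm{AVF}} f(y,x)=\int_0^1\nabla f(\tau y+(1-\tau)x)\,d\tau$. - Gonzalez: for $y\neq x$, $\nabla_{\mathrm{G}} f(y,x)=\nabla f\left(\frac{y+x}{2}\right)+\frac{f(y)-f(x)-\left\langle\nabla f\left(\frac{y+x}{2}\right),y-x\right\rangle}{\|y-x\|^2}(y-x)$, and $\nabla_{\mathrm{G}} f(x,x)=\nabla f(x)$. - Itoh--Abe: the $k$-th component of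 $\nabla_{\mathrm{IA}} f(y,x)$ is $\frac{f(y_1,\dots,y_k,x_{k+1},\dots,x_d)-f(y_1,\dots,y_{k-1},x_k,\dots,x_d)}{y_k-x_k}$ if $y_k\ne x_k$, and the partial derivative $\partial_k f(y_1,\dots,y_{k-1},x_k,\dots,x_d)$ if $y_k=x_k$. *)

theory Defs
  imports "HOL-Analysis.Analysis"
begin

definition grad :: "('a::real_inner \<Rightarrow> real) \<Rightarrow> 'a \<Rightarrow> 'a" where
  "grad f x = (THE D. GDERIV f x :> D)"

definition L_smooth :: "real \<Rightarrow> ('a::real_inner \<Rightarrow> real) \<Rightarrow> bool" where
  "L_smooth L f \<longleftrightarrow> L-lipschitz_on UNIV (grad f)"

definition strongly_convex :: "real \<Rightarrow> ('a::real_inner \<Rightarrow> real) \<Rightarrow> bool" where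
  "strongly_convex \<mu> f \<longleftrightarrow> \<mu> \<ge> 0 \<and> convex_on UNIV (\<lambda>x. f x - \<mu> / 2 * (norm x)\<^sup>2)"

definition weak_discrete_gradient ::
  "('a::real_inner \<Rightarrow> real) \<Rightarrow> ('a \<Rightarrow> 'a \<Rightarrow> 'a) \<Rightarrow> real \<Rightarrow> real \<Rightarrow> real \<Rightarrow> bool" where
  "weak_discrete_gradient f G \<alpha> \<beta> \<gamma> \<longleftrightarrow>
     \<alpha> \<ge> 0 \<and> \<beta> + \<gamma> \<ge> 0 \<and>
     (\<forall>x y z. f y - f x \<le> G y z \<bullet> (y - x) + \<alpha> * (norm (y - z))\<^sup>2
                         - \<beta> * (norm (z - x))\<^sup>2 - \<gamma> * (norm (y - x))\<^sup>2) \<and>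
     (\<forall>x. G x x = grad f x)"

definition avf_grad :: "('a::real_inner \<Rightarrow> real) \<Rightarrow> 'a \<Rightarrow> 'a \<Rightarrow> 'a" where
  "avf_grad f y x = integral {0..1} (\<lambda>\<tau>. grad f (\<tau> *\<^sub>R y + (1 - \<tau>) *\<^sub>R x))"

definition gonzalez_grad :: "('a::real_inner \<Rightarrow> real) \<Rightarrow> 'a \<Rightarrow> 'a \<Rightarrow> 'a" where
  "gonzalez_grad f y x =
     (if y = x then grad f x
      else let g = grad f ((1/2) *\<^sub>R (y + x)) in
        g + ((f y - f x - g \<bullet> (y - x)) / (norm (y - x))\<^sup>2) *\<^sub>R (y - x))"

definition partial_deriv :: "(real^'n \<Rightarrow> real) \<Rightarrow> 'n \<Rightarrow> real^'n \<Rightarrow> real" where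
  "partial_deriv f k p = deriv (\<lambda>t. f (p + t *\<^sub>R axis k 1)) 0"

(* The coordinates 1, ..., d are modelled by a finite linearly ordered index type, so that
   the vectors (y_1, ..., y_k, x_{k+1}, ..., x_d) and (y_1, ..., y_{k-1}, x_k, ..., x_d)
   take their entries from y at the indices i <= k and i < k, respectively. *)
definition itoh_abe_grad ::
  "((real, 'n::{finite,linorder}) vec \<Rightarrow> real) \<Rightarrow> (real, 'n) vec \<Rightarrow> (real, 'n) vec \<Rightarrow> (real, 'n) vec" where
  "itoh_abe_grad f y x =
     (\<chi> k. let p = (\<chi> i. if i \<le> k then y $ i else x $ i);
               q = (\<chi> i. if i < k then y $ i else x $ i)
           in if y $ k = x $ k then partial_deriv f k q
              else (f p - f q) / (y $ k - x $ k))"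

end

theory Submission
  imports Defs
begin

text \<open>
  Strong convexity bounds \<open>f\<close> from below and \<open>L\<close>-smoothness bounds it from above by a quadratic
  tangent at every point. Comparing \<open>f y\<close> and \<open>f x\<close> through the tangents at one point \<open>m\<close> gives (i)
  and (ii) with \<open>m = z\<close> and \<open>m = y\<close>; on the segment from \<open>z\<close> to \<open>y\<close> it gives (iii) at the midpoint
  and (iv) by integration over the segment. The Gonzalez gradient (v) is a correction of the
  midpoint gradient whose size is controlled by the two tangent bounds. For Itoh--Abe (vi), the
  increments telescope to \<open>f y - f z\<close>, and the mean value theorem is applied to
  \<open>f - \<mu>/2 \<parallel>\<cdot>\<parallel>\<^sup>2\<close>, whose gradient is \<open>(L - \<mu>)\<close>-Lipschitz by co-coercivity. Applying it to \<open>f\<close> itself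
  would lose a multiple of \<open>\<mu>\<close> and miss the stated constant.
\<close>

section \<open>Quadratic tangent bounds\<close>

text \<open>\<open>grad\<close> is a definite description, so existence and uniqueness are both
  needed: the values of the derivative on the basis assemble a representing vector, and two
  representing vectors have equal inner products with everything.\<close>

lemma GDERIV_grad:
  fixes f :: "'a::euclidean_space \<Rightarrow> real"
  assumes "f differentiable_on UNIV"
  shows "GDERIV f x :> grad f x"
proof -
  obtain A where A: "(f has_derivative A) (at x)"
    using assms by (auto simp: differentiable_on_def differentiable_def)
  interpret A: bounded_linear A by (rule has_derivative_bounded_linear[OF A])
  have "A = (\<lambda>h. h \<bullet> (\<Sum>b\<in>Basis. A b *\<^sub>R b))"
  proof
    fix h
    have "A h = A (\<Sum>b\<in>Basis. (h \<bullet> b) *\<^sub>R b)" by (simp add: euclidean_representation)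
    also have "\<dots> = (\<Sum>b\<in>Basis. (h \<bullet> b) * A b)" by (simp add: A.sum A.scaleR)
    also have "\<dots> = h \<bullet> (\<Sum>b\<in>Basis. A b *\<^sub>R b)"
      by (simp add: inner_sum_right mult.commute)
    finally show "A h = h \<bullet> (\<Sum>b\<in>Basis. A b *\<^sub>R b)" .
  qed
  then have "GDERIV f x :> (\<Sum>b\<in>Basis. A b *\<^sub>R b)"
    using A unfolding gderiv_def by simp
  moreover have "D = D'" if "GDERIV f x :> D" "GDERIV f x :> D'" for D D'
  proof -
    have "(\<lambda>h. h \<bullet> D) = (\<lambda>h. h \<bullet> D')"
      using that unfolding gderiv_def by (rule has_derivative_unique)
    then show ?thesis using vector_eq_ldot[of D D'] by (simp add: fun_eq_iff)
  qed
  ultimately have "\<exists>!D. GDERIV f x :> D" by blast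
  then show ?thesis unfolding grad_def by (rule theI')
qed

lemma DERIV_along_line:
  assumes "GDERIV f (x + t *\<^sub>R d) :> D"
  shows "((\<lambda>s. f (x + s *\<^sub>R d)) has_real_derivative D \<bullet> d) (at t)"
proof -
  have "((\<lambda>s. x + s *\<^sub>R d) has_derivative (\<lambda>s. s *\<^sub>R d)) (at t)"
    by (auto intro!: derivative_eq_intros)
  from has_derivative_compose[OF this] assms
  have "((\<lambda>s. f (x + s *\<^sub>R d)) has_derivative (\<lambda>s. (s *\<^sub>R d) \<bullet> D)) (at t)"
    unfolding gderiv_def by blast
  then show ?thesis
    by (simp add: has_field_derivative_def inner_commute mult_commute_abs)
qed

text \<open>The convex function \<open>h\<close> is restricted to the line through \<open>y\<close>
  and \<open>x\<close>, where the one-variable tangent inequality applies. The quadratic exceeds its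
  own tangent at \<open>y\<close> by exactly
  \<open>\<mu> / 2 * (norm (x - y))\<^sup>2\<close>.\<close>

lemma strongly_convex_above_tangent:
  fixes f :: "'a::euclidean_space \<Rightarrow> real"
  assumes "f differentiable_on UNIV" "strongly_convex \<mu> f"
  shows "f y + grad f y \<bullet> (x - y) + \<mu> / 2 * (norm (x - y))\<^sup>2 \<le> f x"
proof -
  define h where "h = (\<lambda>x. f x - \<mu> / 2 * (norm x)\<^sup>2)"
  define k where "k = (\<lambda>t. h (y + t *\<^sub>R (x - y)))"
  have h: "convex_on UNIV h" using assms by (simp add: strongly_convex_def h_def)
  have "convex_on UNIV k"
  proof (rule convex_onI)
    fix t a b :: real assume t: "0 < t" "t < 1"
    have "y + ((1 - t) *\<^sub>R a + t *\<^sub>R b) *\<^sub>R (x - y) =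
        (1 - t) *\<^sub>R (y + a *\<^sub>R (x - y)) + t *\<^sub>R (y + b *\<^sub>R (x - y))"
      by (simp add: algebra_simps)
    then show "k ((1 - t) *\<^sub>R a + t *\<^sub>R b) \<le> (1 - t) * k a + t * k b"
      unfolding k_def using convex_onD[OF h, of t] t by simp
  qed simp
  moreover have "(k has_real_derivative grad f y \<bullet> (x - y) - \<mu> * (y \<bullet> (x - y))) (at 0)"
  proof -
    have k: "k = (\<lambda>t. f (y + t *\<^sub>R (x - y)) - \<mu> / 2 *
        (y \<bullet> y + 2 * t * (y \<bullet> (x - y)) + t\<^sup>2 * ((x - y) \<bullet> (x - y))))"
      by (rule ext, simp only: k_def h_def power2_norm_eq_inner,
          simp add: inner_add inner_diff inner_commute power2_eq_square algebra_simps)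
    have "((\<lambda>t. f (y + t *\<^sub>R (x - y))) has_real_derivative grad f y \<bullet> (x - y)) (at 0)"
      by (rule DERIV_along_line) (simp add: GDERIV_grad assms(1))
    then show ?thesis unfolding k by (auto intro!: derivative_eq_intros)
  qed
  ultimately have "(grad f y \<bullet> (x - y) - \<mu> * (y \<bullet> (x - y))) * (1 - 0) \<le> k 1 - k 0"
    by (intro convex_on_imp_above_tangent[where A = UNIV]) auto
  moreover have "k 1 = h x" "k 0 = h y" by (simp_all add: k_def)
  ultimately have "grad f y \<bullet> (x - y) - \<mu> * (y \<bullet> (x - y)) \<le> h x - h y" by simp
  then show ?thesis
    unfolding h_def power2_norm_eq_inner
    by (simp add: inner_diff inner_commute algebra_simps)
qed

lemma L_smooth_norm_grad_diff_le:
  assumes "L_smooth L f"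
  shows "norm (grad f x - grad f y) \<le> L * norm (x - y)"
  using lipschitz_onD[of L UNIV "grad f" x y] assms by (simp add: L_smooth_def dist_norm)

lemma L_smooth_nonneg: "L_smooth L f \<Longrightarrow> 0 \<le> L"
  by (simp add: L_smooth_def lipschitz_on_def)

text \<open>Along the segment, \<open>f\<close> minus its tangent and minus the quadratic is
  nonincreasing, by Cauchy-Schwarz and the Lipschitz bound; its endpoint values are
  compared.\<close>

lemma L_smooth_below_tangent:
  fixes f :: "'a::euclidean_space \<Rightarrow> real"
  assumes "f differentiable_on UNIV" "L_smooth L f"
  shows "f x \<le> f y + grad f y \<bullet> (x - y) + L / 2 * (norm (x - y))\<^sup>2"
proof -
  define d where "d = x - y"
  define k where "k = (\<lambda>t. f (y + t *\<^sub>R d) - t * (grad f y \<bullet> d) - t\<^sup>2 * (L / 2 * (norm d)\<^sup>2))"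
  have "k 1 \<le> k 0"
  proof (rule DERIV_nonpos_imp_nonincreasing[of 0 1 k])
    fix t :: real assume t: "0 \<le> t" "t \<le> 1"
    have "((\<lambda>t. f (y + t *\<^sub>R d)) has_real_derivative grad f (y + t *\<^sub>R d) \<bullet> d) (at t)"
      by (rule DERIV_along_line) (simp add: GDERIV_grad assms(1))
    then have "(k has_real_derivative
        (grad f (y + t *\<^sub>R d) - grad f y) \<bullet> d - t * L * (norm d)\<^sup>2) (at t)"
      unfolding k_def by (auto intro!: derivative_eq_intros simp: inner_diff)
    moreover have "(grad f (y + t *\<^sub>R d) - grad f y) \<bullet> d \<le> t * L * (norm d)\<^sup>2"
    proof -
      have "(grad f (y + t *\<^sub>R d) - grad f y) \<bullet> d \<le> norm (grad f (y + t *\<^sub>R d) - grad f y) * norm d"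
        by (rule norm_cauchy_schwarz)
      also have "\<dots> \<le> (L * norm ((y + t *\<^sub>R d) - y)) * norm d"
        by (intro mult_right_mono L_smooth_norm_grad_diff_le assms) simp
      finally show ?thesis using t by (simp add: power2_eq_square algebra_simps)
    qed
    ultimately show "\<exists>D. (k has_real_derivative D) (at t) \<and> D \<le> 0" by force
  qed simp
  then show ?thesis by (simp add: k_def d_def)
qed

text \<open>The two tangent bounds at 0 enclose the same value of \<open>f\<close> at a unit
  vector.\<close>

lemma strong_convexity_le_smoothness:
  fixes f :: "'a::euclidean_space \<Rightarrow> real"
  assumes "f differentiable_on UNIV" "strongly_convex \<mu> f" "L_smooth L f"
  shows "\<mu> \<le> L"
proof -
  obtain b :: 'a where "b \<in> Basis" using nonempty_Basis by blast
  then have "norm (b - 0) = 1" by simp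
  then show ?thesis
    using strongly_convex_above_tangent[OF assms(1,2), of 0 b]
      L_smooth_below_tangent[OF assms(1,3), of b 0] by simp
qed

text \<open>Co-coercivity: the lower bound at \<open>x\<close> and the upper bound at \<open>y\<close> are compared at the point \<open>w\<close>
  that is one gradient step from \<open>y\<close>, for the function \<open>h\<close> minus its tangent at \<open>x\<close>.\<close>

lemma lipschitz_of_tangent_bounds:
  fixes h :: "'a::real_inner \<Rightarrow> real" and G :: "'a \<Rightarrow> 'a"
  assumes low: "\<And>x y. h y + G y \<bullet> (x - y) \<le> h x"
    and upp: "\<And>x y. h x \<le> h y + G y \<bullet> (x - y) + M / 2 * (norm (x - y))\<^sup>2"
    and "0 \<le> M"
  shows "norm (G x - G y) \<le> M * norm (x - y)"
proof -
  \<comment> \<open>The step length is a reciprocal and \<open>M\<close> may be 0, so the bound is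
    first proved for every \<open>K > M\<close>; letting \<open>K\<close> decrease to
    \<open>M\<close> finishes.\<close>
  have *: "norm (G x - G y) \<le> K * norm (x - y)" if "K > M" for K
  proof -
    have K: "K > 0" using that assms by simp
    have co: "h x + G x \<bullet> (y - x) + (norm (G x - G y))\<^sup>2 / (2 * K) \<le> h y" for x y
    proof -
      define v where "v = G y - G x"
      define w where "w = y - (1 / K) *\<^sub>R v"
      have "h x + G x \<bullet> (w - x) \<le> h y + G y \<bullet> (w - y) + M / 2 * (norm (w - y))\<^sup>2"
        using low[of x w] upp[of w y] by simp
      moreover have "G y \<bullet> (w - y) - G x \<bullet> (w - x) = - ((norm v)\<^sup>2 / K) - G x \<bullet> (y - x)"
      proof -
        have "G y \<bullet> (w - y) - G x \<bullet> (w - x) = v \<bullet> (w - y) - G x \<bullet> (y - x)"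
          by (simp add: v_def inner_diff)
        then show ?thesis by (simp add: w_def power2_norm_eq_inner)
      qed
      moreover have "M / 2 * (norm (w - y))\<^sup>2 \<le> (norm v)\<^sup>2 / (2 * K)"
      proof -
        have "M / 2 * (norm (w - y))\<^sup>2 \<le> K / 2 * (norm (w - y))\<^sup>2"
          using that by (intro mult_right_mono) auto
        moreover have "K / 2 * (norm (w - y))\<^sup>2 = (norm v)\<^sup>2 / (2 * K)"
          using K by (simp add: w_def power_divide power2_eq_square)
        ultimately show ?thesis by simp
      qed
      moreover have "(norm v)\<^sup>2 / K = (norm v)\<^sup>2 / (2 * K) + (norm v)\<^sup>2 / (2 * K)"
        by (simp add: field_simps)
      ultimately have "h x + G x \<bullet> (y - x) + (norm v)\<^sup>2 / (2 * K) \<le> h y" by linarith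
      then show ?thesis by (simp add: v_def norm_minus_commute)
    qed
    define n where "n = norm (G x - G y)"
    \<comment> \<open>Adding \<open>co\<close> to its copy with \<open>x\<close> and
      \<open>y\<close> exchanged cancels the values of \<open>h\<close>.\<close>
    have "n\<^sup>2 / (2 * K) + n\<^sup>2 / (2 * K) \<le> (G x - G y) \<bullet> (x - y)"
      using co[of x y] co[of y x] by (simp add: n_def norm_minus_commute inner_diff)
    also have "\<dots> \<le> n * norm (x - y)" unfolding n_def by (rule norm_cauchy_schwarz)
    finally have "n * n \<le> n * (K * norm (x - y))"
      using K by (simp add: field_simps power2_eq_square)
    then have "n \<le> K * norm (x - y)"
      using K by (cases "n = 0") (auto simp: n_def mult_le_cancel_left_pos)
    then show ?thesis by (simp add: n_def)
  qed
  show ?thesis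
  proof (cases "x = y")
    case False
    have "norm (G x - G y) / norm (x - y) \<le> M"
      by (rule dense_ge) (use * False in \<open>simp add: field_simps\<close>)
    then show ?thesis using False by (simp add: field_simps)
  qed simp
qed

text \<open>Subtracting the quadratic lowers both tangent constants by \<mu>, to 0 and
  \<open>L - \<mu>\<close>. The triangle inequality would only give
  \<open>L + \<mu>\<close>.\<close>

lemma lipschitz_grad_minus_quadratic:
  fixes f :: "'a::euclidean_space \<Rightarrow> real"
  assumes "f differentiable_on UNIV" "strongly_convex \<mu> f" "L_smooth L f"
  shows "norm ((grad f x - \<mu> *\<^sub>R x) - (grad f y - \<mu> *\<^sub>R y)) \<le> (L - \<mu>) * norm (x - y)"
proof (rule lipschitz_of_tangent_bounds[where h = "\<lambda>x. f x - \<mu> / 2 * (norm x)\<^sup>2"])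
  have *: "\<mu> / 2 * (norm x)\<^sup>2 = \<mu> / 2 * (norm y)\<^sup>2 + \<mu> * (y \<bullet> (x - y)) + \<mu> / 2 * (norm (x - y))\<^sup>2"
    for x y :: 'a
    by (simp only: power2_norm_eq_inner) (simp add: inner_diff inner_commute algebra_simps)
  fix x y
  show "f y - \<mu> / 2 * (norm y)\<^sup>2 + (grad f y - \<mu> *\<^sub>R y) \<bullet> (x - y) \<le> f x - \<mu> / 2 * (norm x)\<^sup>2"
    using strongly_convex_above_tangent[OF assms(1,2), of y x] *[of x y]
    by (simp add: inner_diff_left add_divide_distrib)
  show "f x - \<mu> / 2 * (norm x)\<^sup>2 \<le> f y - \<mu> / 2 * (norm y)\<^sup>2 + (grad f y - \<mu> *\<^sub>R y) \<bullet> (x - y)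
      + (L - \<mu>) / 2 * (norm (x - y))\<^sup>2"
    using L_smooth_below_tangent[OF assms(1,3), of x y] *[of x y]
    by (simp add: inner_diff_left add_divide_distrib diff_divide_distrib left_diff_distrib)
qed (use strong_convexity_le_smoothness[OF assms] in simp)

section \<open>Gradients at points of the segment\<close>

text \<open>The upper bound is taken at \<open>y\<close> and the lower bound at \<open>x\<close>,
  both from the tangent at \<open>m\<close>; \<open>f m\<close> cancels.\<close>

lemma three_point_bound:
  fixes f :: "'a::euclidean_space \<Rightarrow> real"
  assumes "f differentiable_on UNIV" "strongly_convex \<mu> f" "L_smooth L f"
  shows "f y - f x \<le> grad f m \<bullet> (y - x) + L / 2 * (norm (y - m))\<^sup>2 - \<mu> / 2 * (norm (x - m))\<^sup>2"
  using strongly_convex_above_tangent[OF assms(1,2), of m x]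
    L_smooth_below_tangent[OF assms(1,3), of y m]
  by (simp add: inner_diff_right)

lemma segment_bound:
  fixes f :: "'a::euclidean_space \<Rightarrow> real"
  assumes "f differentiable_on UNIV" "strongly_convex \<mu> f" "L_smooth L f"
  shows "f y - f x \<le> grad f (t *\<^sub>R y + (1 - t) *\<^sub>R z) \<bullet> (y - x)
    + (L / 2 * (1 - t)\<^sup>2 + \<mu> / 2 * (t * (1 - t))) * (norm (y - z))\<^sup>2
    - \<mu> / 2 * (1 - t) * (norm (z - x))\<^sup>2 - \<mu> / 2 * t * (norm (y - x))\<^sup>2"
proof -
  define m where "m = t *\<^sub>R y + (1 - t) *\<^sub>R z"
  have "y - m = (1 - t) *\<^sub>R (y - z)" by (simp add: m_def algebra_simps)
  then have 1: "(norm (y - m))\<^sup>2 = (1 - t)\<^sup>2 * (norm (y - z))\<^sup>2"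
    by (simp add: power_mult_distrib)
  \<comment> \<open>Stewart's identity for the distance from \<open>x\<close> to a point on the line
    through \<open>y\<close> and \<open>z\<close>; its last term is the source of \<mu> in the
    coefficient of \<open>(norm (y - z))\<^sup>2\<close>.\<close>
  have 2: "(norm (x - m))\<^sup>2 = t * (norm (y - x))\<^sup>2 + (1 - t) * (norm (z - x))\<^sup>2
      - t * (1 - t) * (norm (y - z))\<^sup>2"
    by (simp only: power2_norm_eq_inner m_def)
      (simp add: inner_diff inner_add inner_commute power2_eq_square algebra_simps)
  show ?thesis
    using three_point_bound[OF assms, of y x m] unfolding 1 2 m_def[symmetric]
    by (simp add: algebra_simps diff_divide_distrib)
qed

section \<open>Parameters of the explicit, implicit, midpoint and averaged gradients\<close>

lemma weak_discrete_gradient_explicit: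
  fixes f :: "'a::euclidean_space \<Rightarrow> real"
  assumes "f differentiable_on UNIV" "strongly_convex \<mu> f" "L_smooth L f"
  shows "weak_discrete_gradient f (\<lambda>y x. grad f x) (L / 2) (\<mu> / 2) 0"
proof -
  have "f y - f x \<le> grad f z \<bullet> (y - x) + L / 2 * (norm (y - z))\<^sup>2
      - \<mu> / 2 * (norm (z - x))\<^sup>2 - 0 * (norm (y - x))\<^sup>2" for x y z
    using segment_bound[OF assms, of y x 0 z] by simp
  then show ?thesis
    unfolding weak_discrete_gradient_def
    using L_smooth_nonneg[OF assms(3)] assms(2) by (simp add: strongly_convex_def)
qed

lemma weak_discrete_gradient_implicit:
  fixes f :: "'a::euclidean_space \<Rightarrow> real"
  assumes "f differentiable_on UNIV" "strongly_convex \<mu> f"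
  shows "weak_discrete_gradient f (\<lambda>y x. grad f y) 0 0 (\<mu> / 2)"
proof -
  have "f y - f x \<le> grad f y \<bullet> (y - x) - \<mu> / 2 * (norm (y - x))\<^sup>2" for x y
    using strongly_convex_above_tangent[OF assms, of y x]
    by (simp add: inner_diff_right norm_minus_commute)
  then show ?thesis
    using assms(2) by (simp add: weak_discrete_gradient_def strongly_convex_def)
qed

text \<open>The case \<open>t = 1/2\<close> of \<open>segment_bound\<close>, kept separate because
  the Gonzalez gradient perturbs it.\<close>

lemma midpoint_bound:
  fixes f :: "'a::euclidean_space \<Rightarrow> real"
  assumes "f differentiable_on UNIV" "strongly_convex \<mu> f" "L_smooth L f"
  shows "f y - f x \<le> grad f ((1/2) *\<^sub>R (z + y)) \<bullet> (y - x) + (L + \<mu>) / 8 * (norm (y - z))\<^sup>2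
    - \<mu> / 4 * (norm (z - x))\<^sup>2 - \<mu> / 4 * (norm (y - x))\<^sup>2"
proof -
  have "(1/2) *\<^sub>R y + (1 - 1/2) *\<^sub>R z = (1/2) *\<^sub>R (z + y)" by (simp add: algebra_simps)
  then show ?thesis
    using segment_bound[OF assms, of y x "1/2" z]
    by (simp add: power2_eq_square field_simps)
qed

lemma weak_discrete_gradient_midpoint:
  fixes f :: "'a::euclidean_space \<Rightarrow> real"
  assumes "f differentiable_on UNIV" "strongly_convex \<mu> f" "L_smooth L f"
  shows "weak_discrete_gradient f (\<lambda>y x. grad f ((1/2) *\<^sub>R (x + y))) ((L + \<mu>) / 8) (\<mu> / 4) (\<mu> / 4)"
proof -
  have "(1/2) *\<^sub>R (x + x) = x" for x :: 'a by (simp flip: scaleR_2)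
  then show ?thesis
    unfolding weak_discrete_gradient_def
    using midpoint_bound[OF assms] L_smooth_nonneg[OF assms(3)] assms(2)
    by (simp add: strongly_convex_def)
qed

text \<open>\<open>segment_bound\<close> is integrated over \<open>t\<close> in
  \<open>{0..1}\<close>. The integrals of \<open>(1 - t)\<^sup>2\<close>,
  \<open>t * (1 - t)\<close>, \<open>t\<close> and \<open>1 - t\<close> are 1/3, 1/6, 1/2 and 1/2,
  which gives the constants.\<close>

lemma weak_discrete_gradient_avf:
  fixes f :: "'a::euclidean_space \<Rightarrow> real"
  assumes "f differentiable_on UNIV" "strongly_convex \<mu> f" "L_smooth L f"
  shows "weak_discrete_gradient f (avf_grad f) (L / 6 + \<mu> / 12) (\<mu> / 4) (\<mu> / 4)"
proof -
  have cont: "continuous_on UNIV (grad f)"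
    using assms(3) unfolding L_smooth_def by (rule lipschitz_on_continuous_on)
  have bound: "f y - f x \<le> avf_grad f y z \<bullet> (y - x) + (L / 6 + \<mu> / 12) * (norm (y - z))\<^sup>2
      - \<mu> / 4 * (norm (z - x))\<^sup>2 - \<mu> / 4 * (norm (y - x))\<^sup>2" for x y z
  proof -
    define P where "P = (norm (y - z))\<^sup>2"
    define Q where "Q = (norm (z - x))\<^sup>2"
    define R where "R = (norm (y - x))\<^sup>2"
    define r where "r = (\<lambda>t. (L / 2 * (1 - t)\<^sup>2 + \<mu> / 2 * (t * (1 - t))) * P
      - \<mu> / 2 * (1 - t) * Q - \<mu> / 2 * t * R)"
    define S where "S = (\<lambda>t. (- (L / 6 * (1 - t)^3) + \<mu> / 2 * (t\<^sup>2 / 2 - t^3 / 3)) * P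
      - \<mu> / 2 * (t - t\<^sup>2 / 2) * Q - \<mu> / 2 * (t\<^sup>2 / 2) * R)"
    \<comment> \<open>Continuity makes the integrand integrable, so \<open>avf_grad\<close> is a
      genuine integral and not a default value.\<close>
    have "continuous_on {0..1} (\<lambda>t. grad f (t *\<^sub>R y + (1 - t) *\<^sub>R z))"
      by (rule continuous_on_compose2[OF cont]) (auto intro!: continuous_intros)
    then have "((\<lambda>t. grad f (t *\<^sub>R y + (1 - t) *\<^sub>R z)) has_integral avf_grad f y z) {0..1}"
      unfolding avf_grad_def
      by (intro integrable_integral integrable_continuous_interval)
    from has_integral_linear[OF this bounded_linear_inner_left[of "y - x"]]
    have 1: "((\<lambda>t. grad f (t *\<^sub>R y + (1 - t) *\<^sub>R z) \<bullet> (y - x)) has_integral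
        avf_grad f y z \<bullet> (y - x)) {0..1}" by (simp add: o_def)
    have "(r has_integral S 1 - S 0) {0..1}"
    proof (rule fundamental_theorem_of_calculus)
      fix t :: real
      have "(S has_real_derivative r t) (at t)"
        unfolding S_def r_def
        by (auto intro!: derivative_eq_intros
            simp: power2_eq_square algebra_simps add_divide_distrib diff_divide_distrib)
      then show "(S has_vector_derivative r t) (at t within {0..1})"
        by (simp add: has_real_derivative_iff_has_vector_derivative
            has_vector_derivative_at_within)
    qed simp
    from has_integral_add[OF 1 this]
    have sum: "((\<lambda>t. grad f (t *\<^sub>R y + (1 - t) *\<^sub>R z) \<bullet> (y - x) + r t) has_integral
        avf_grad f y z \<bullet> (y - x) + (S 1 - S 0)) {0..1}" .
    have const: "((\<lambda>t. f y - f x) has_integral f y - f x) {0..1::real}"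
      using has_integral_const_real[of "f y - f x" 0 1] by simp
    have "f y - f x \<le> grad f (t *\<^sub>R y + (1 - t) *\<^sub>R z) \<bullet> (y - x) + r t" for t
      using segment_bound[OF assms, of y x t z] by (simp add: r_def P_def Q_def R_def)
    then have "f y - f x \<le> avf_grad f y z \<bullet> (y - x) + (S 1 - S 0)"
      using has_integral_le[OF const sum] by blast
    moreover have "S 1 - S 0 = (L / 6 + \<mu> / 12) * P - \<mu> / 4 * Q - \<mu> / 4 * R"
      by (simp add: S_def algebra_simps)
    ultimately show ?thesis by (simp add: P_def Q_def R_def)
  qed
  have "avf_grad f x x = grad f x" for x
    by (simp add: avf_grad_def flip: scaleR_left_distrib)
  then show ?thesis
    unfolding weak_discrete_gradient_def
    using bound L_smooth_nonneg[OF assms(3)] assms(2) by (simp add: strongly_convex_def)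
qed

section \<open>The Gonzalez gradient\<close>

text \<open>From the midpoint, \<open>y\<close> and \<open>z\<close> lie in opposite directions at
  equal distance. Each expansion has an error between \<mu>/8 and L/8 times the squared distance of
  \<open>y\<close> and \<open>z\<close>, and the difference of the two expansions cancels
  \<open>f m\<close>.\<close>

lemma midpoint_gradient_defect:
  fixes f :: "'a::euclidean_space \<Rightarrow> real"
  assumes "f differentiable_on UNIV" "strongly_convex \<mu> f" "L_smooth L f"
  shows "\<bar>f y - f z - grad f ((1/2) *\<^sub>R (y + z)) \<bullet> (y - z)\<bar> \<le> (L - \<mu>) / 8 * (norm (y - z))\<^sup>2"
proof -
  define m where "m = (1/2) *\<^sub>R (y + z)"
  have "y - m = (1/2) *\<^sub>R (y - z)" "z - m = - (1/2) *\<^sub>R (y - z)"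
    by (simp_all add: m_def algebra_simps flip: scaleR_left_distrib)
  then have d: "grad f m \<bullet> (y - m) = grad f m \<bullet> (y - z) / 2"
    "grad f m \<bullet> (z - m) = - grad f m \<bullet> (y - z) / 2"
    "(norm (y - m))\<^sup>2 = (norm (y - z))\<^sup>2 / 4" "(norm (z - m))\<^sup>2 = (norm (y - z))\<^sup>2 / 4"
    by (simp_all add: power_divide)
  show ?thesis
    using strongly_convex_above_tangent[OF assms(1,2), of m y, unfolded d]
      strongly_convex_above_tangent[OF assms(1,2), of m z, unfolded d]
      L_smooth_below_tangent[OF assms(1,3), of y m, unfolded d]
      L_smooth_below_tangent[OF assms(1,3), of z m, unfolded d]
    unfolding m_def[symmetric] by (simp add: abs_le_iff algebra_simps diff_divide_distrib abs_if)
qed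

text \<open>The correction to the midpoint gradient contributes at most
  \<open>(L - \<mu>) / 8 * (n * c)\<close> in absolute value. A Young inequality splits this
  product, spending the whole term \<open>\<mu> / 4 * c\<^sup>2\<close> of the midpoint bound; hence
  the last parameter 0.\<close>

lemma weak_discrete_gradient_gonzalez:
  fixes f :: "'a::euclidean_space \<Rightarrow> real"
  assumes "f differentiable_on UNIV" "strongly_convex \<mu> f" "L_smooth L f" "\<mu> > 0"
  shows "weak_discrete_gradient f (gonzalez_grad f)
    ((L + \<mu>) / 8 + (L - \<mu>)\<^sup>2 / (16 * \<mu>)) (\<mu> / 4) 0"
proof -
  note mid = midpoint_bound[OF assms(1-3)]
  define K where "K = (L - \<mu>)\<^sup>2 / (16 * \<mu>)"
  have K: "K \<ge> 0" using assms(4) by (simp add: K_def)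
  have bound: "f y - f x \<le> gonzalez_grad f y z \<bullet> (y - x) + ((L + \<mu>) / 8 + K) * (norm (y - z))\<^sup>2
      - \<mu> / 4 * (norm (z - x))\<^sup>2" for x y z
  proof (cases "y = z")
    case True
    have "(1/2) *\<^sub>R (y + y) = y" by (simp flip: scaleR_2)
    moreover have "\<mu> / 4 * (norm (y - x))\<^sup>2 \<ge> 0" using assms(4) by simp
    ultimately show ?thesis
      using True mid[of y x z] by (simp add: gonzalez_grad_def)
  next
    case False
    define g where "g = grad f ((1/2) *\<^sub>R (y + z))"
    define E where "E = f y - f z - g \<bullet> (y - z)"
    define n where "n = norm (y - z)"
    define c where "c = norm (y - x)"
    define M where "M = L - \<mu>"
    have n: "n > 0" using False by (simp add: n_def)
    have G: "gonzalez_grad f y z \<bullet> (y - x) = g \<bullet> (y - x) + E / n\<^sup>2 * ((y - z) \<bullet> (y - x))"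
      using False by (simp add: gonzalez_grad_def Let_def inner_add_left g_def E_def n_def)
    have "\<bar>E / n\<^sup>2\<bar> \<le> M / 8"
      using midpoint_gradient_defect[OF assms(1-3), of y z] n
      by (simp add: E_def g_def n_def M_def field_simps)
    moreover have "\<bar>(y - z) \<bullet> (y - x)\<bar> \<le> n * c"
      unfolding n_def c_def by (rule Cauchy_Schwarz_ineq2)
    ultimately have "\<bar>E / n\<^sup>2\<bar> * \<bar>(y - z) \<bullet> (y - x)\<bar> \<le> M / 8 * (n * c)"
      by (rule mult_mono'[OF _ _ abs_ge_zero abs_ge_zero])
    also have "\<dots> \<le> K * n\<^sup>2 + \<mu> / 4 * c\<^sup>2"
    proof -
      \<comment> \<open>The square is scaled so that its cross term is the product to be absorbed
        and its first term is \<open>K * n\<^sup>2\<close>; it supplies 1/16 of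
        \<open>\<mu> * c\<^sup>2\<close>, and 3/16 is added to reach 1/4.\<close>
      have "0 \<le> (M * n - \<mu> * c)\<^sup>2 / (16 * \<mu>) + 3 / 16 * \<mu> * c\<^sup>2" using assms(4) by simp
      also have "\<dots> = K * n\<^sup>2 + \<mu> / 4 * c\<^sup>2 - M / 8 * (n * c)"
        unfolding K_def M_def[symmetric] using assms(4)
        by (simp add: power2_eq_square field_simps)
      finally show ?thesis by simp
    qed
    finally have "- (E / n\<^sup>2 * ((y - z) \<bullet> (y - x))) \<le> K * n\<^sup>2 + \<mu> / 4 * c\<^sup>2"
      using abs_ge_minus_self[of "E / n\<^sup>2 * ((y - z) \<bullet> (y - x))"] unfolding abs_mult by linarith
    then show ?thesis
      using mid[of y x z] unfolding G
      by (simp add: g_def n_def c_def add.commute distrib_right)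
  qed
  show ?thesis
    unfolding weak_discrete_gradient_def
    using bound K L_smooth_nonneg[OF assms(3)] assms(4)
    by (simp add: K_def gonzalez_grad_def)
qed

section \<open>The Itoh--Abe gradient\<close>

lemma partial_deriv_eq_grad:
  fixes f :: "real^'n \<Rightarrow> real"
  assumes "f differentiable_on UNIV"
  shows "partial_deriv f k p = grad f p $ k"
proof -
  have "((\<lambda>t. f (p + t *\<^sub>R axis k 1)) has_real_derivative grad f p \<bullet> axis k 1) (at 0)"
    by (rule DERIV_along_line) (simp add: GDERIV_grad assms)
  then show ?thesis by (simp add: partial_deriv_def DERIV_imp_deriv inner_axis)
qed

text \<open>Removing the largest index leaves all other initial segments unchanged, and that index
  contributes the last increment.\<close>

lemma sum_telescope_initial_segments:
  fixes F :: "'i::linorder set \<Rightarrow> 'b::ab_group_add"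
  assumes "finite A"
  shows "(\<Sum>k\<in>A. F {i\<in>A. i \<le> k} - F {i\<in>A. i < k}) = F A - F {}"
  using assms
proof (induction A rule: finite_linorder_max_induct)
  case (insert b A)
  have "{i\<in>insert b A. i \<le> k} = {i\<in>A. i \<le> k}" "{i\<in>insert b A. i < k} = {i\<in>A. i < k}"
    if "k \<in> A" for k
    using insert.hyps(2) that by (auto simp: not_less[symmetric])
  moreover have "{i\<in>insert b A. i \<le> b} = insert b A" "{i\<in>insert b A. i < b} = A"
    using insert.hyps(2) by auto
  moreover have "b \<notin> A" using insert.hyps(2) by auto
  ultimately show ?case using insert by simp
qed simp

lemma itoh_abe_discrete_chain_rule:
  fixes f :: "real^'n::{finite,linorder} \<Rightarrow> real"
  shows "itoh_abe_grad f y x \<bullet> (y - x) = f y - f x"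
proof -
  define F where "F = (\<lambda>S. f (\<chi> i. if i \<in> S then y $ i else x $ i))"
  have "itoh_abe_grad f y x $ k * (y $ k - x $ k) = F {i. i \<le> k} - F {i. i < k}" for k
  proof (cases "y $ k = x $ k")
    \<comment> \<open>Here both sides vanish, whatever value the partial-derivative branch
      takes.\<close>
    case True
    then have "(\<chi> i. if i \<le> k then y $ i else x $ i) = (\<chi> i. if i < k then y $ i else x $ i)"
      by (auto simp: vec_eq_iff)
    with True show ?thesis by (simp add: F_def)
  qed (simp add: itoh_abe_grad_def Let_def F_def)
  then have "itoh_abe_grad f y x \<bullet> (y - x) = (\<Sum>k\<in>UNIV. F {i. i \<le> k} - F {i. i < k})"
    by (simp add: inner_vec_def)
  also have "\<dots> = F UNIV - F {}"
    using sum_telescope_initial_segments[of UNIV F] by simp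
  finally show ?thesis by (simp add: F_def)
qed

text \<open>The quadratic has the exact divided difference
  \<open>\<mu> / 2 * (y $ k + x $ k)\<close>; the mean value theorem is spent only on the remainder.
  The norm bound keeps \<open>w\<close> close enough to \<open>x\<close> for the Lipschitz
  estimate.\<close>

lemma itoh_abe_mean_value:
  fixes f :: "real^'n::{finite,linorder} \<Rightarrow> real"
  assumes "f differentiable_on UNIV"
  shows "\<exists>w. itoh_abe_grad f y x $ k = (grad f w - \<mu> *\<^sub>R w) $ k + \<mu> / 2 * (y $ k + x $ k)
    \<and> norm (w - x) \<le> norm (y - x)"
proof -
  define p where "p = (\<chi> i. if i \<le> k then y $ i else x $ i)"
  define q where "q = (\<chi> i. if i < k then y $ i else x $ i)"
  define b where "b = y $ k - x $ k"
  \<comment> \<open>Relative to \<open>x\<close>, coordinates below \<open>k\<close> move to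
    \<open>y\<close>, coordinate \<open>k\<close> moves by the fraction \<open>s\<close>, and later
    ones stay fixed.\<close>
  have le: "norm (q + (s * b) *\<^sub>R axis k 1 - x) \<le> norm (y - x)" if "0 \<le> s" "s \<le> 1" for s
  proof (rule norm_le_componentwise_cart)
    fix i
    have "\<bar>s * b\<bar> \<le> \<bar>b\<bar>" using that by (simp add: abs_mult mult_left_le_one_le)
    then show "norm ((q + (s * b) *\<^sub>R axis k 1 - x) $ i) \<le> norm ((y - x) $ i)"
      by (auto simp: q_def b_def axis_def)
  qed
  show ?thesis
  proof (cases "b = 0")
    case True
    then have "itoh_abe_grad f y x $ k = grad f q $ k"
      by (simp add: itoh_abe_grad_def b_def q_def partial_deriv_eq_grad[OF assms])
    moreover have "y $ k = x $ k" "q $ k = x $ k" using True by (simp_all add: b_def q_def)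
    ultimately show ?thesis using le[of 0] by (intro exI[of _ q]) simp
  next
    case False
    \<comment> \<open>Only coordinate \<open>k\<close> of the quadratic is subtracted, since the
      others are constant along this line.\<close>
    define \<psi> where "\<psi> = (\<lambda>s. f (q + s *\<^sub>R (b *\<^sub>R axis k 1)) - \<mu> / 2 * (x $ k + s * b)\<^sup>2)"
    define H where "H = (\<lambda>s. let w = q + (s * b) *\<^sub>R axis k 1 in (grad f w - \<mu> *\<^sub>R w) $ k)"
    have "(\<psi> has_real_derivative b * H s) (at s)" for s
    proof -
      have "((\<lambda>s. f (q + s *\<^sub>R (b *\<^sub>R axis k 1))) has_real_derivative
          grad f (q + s *\<^sub>R (b *\<^sub>R axis k 1)) \<bullet> (b *\<^sub>R axis k 1)) (at s)"
        by (rule DERIV_along_line) (rule GDERIV_grad[OF assms])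
      then show ?thesis
        unfolding \<psi>_def H_def Let_def
        by (auto intro!: derivative_eq_intros simp: inner_axis q_def algebra_simps)
    qed
    then obtain s where s: "0 < s" "s < 1" "\<psi> 1 - \<psi> 0 = (1 - 0) * (b * H s)"
      using MVT2[of 0 1 \<psi> "\<lambda>s. b * H s"] by auto
    have "q + b *\<^sub>R axis k 1 = p"
      by (auto simp: vec_eq_iff p_def q_def b_def axis_def)
    then have "\<psi> 1 - \<psi> 0 = f p - f q - b * (\<mu> / 2 * (y $ k + x $ k))"
      by (simp add: \<psi>_def b_def power2_eq_square field_simps)
    with s(3) False have "(f p - f q) / b = H s + \<mu> / 2 * (y $ k + x $ k)"
      by (simp add: field_simps)
    moreover have "itoh_abe_grad f y x $ k = (f p - f q) / b"
      using False by (simp add: itoh_abe_grad_def Let_def p_def q_def b_def)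
    ultimately show ?thesis using le[of s] s
      by (intro exI[of _ "q + (s * b) *\<^sub>R axis k 1"]) (simp add: H_def Let_def)
  qed
qed

text \<open>The shift by \<open>(\<mu> / 2) *\<^sub>R (y - x)\<close> turns each component into
  \<open>D $ k + \<mu> * (y - x) $ k\<close>, bounded with constant
  \<open>(L - \<mu>) + \<mu> = L\<close>. Summing squares over the coordinates gives the factor
  \<open>CARD('n)\<close>.\<close>

lemma itoh_abe_defect:
  fixes f :: "real^'n::{finite,linorder} \<Rightarrow> real"
  assumes "f differentiable_on UNIV" "strongly_convex \<mu> f" "L_smooth L f"
  shows "(norm (itoh_abe_grad f y x - grad f x + (\<mu> / 2) *\<^sub>R (y - x)))\<^sup>2
    \<le> real CARD('n) * L\<^sup>2 * (norm (y - x))\<^sup>2"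
proof -
  define V where "V = itoh_abe_grad f y x - grad f x + (\<mu> / 2) *\<^sub>R (y - x)"
  have \<mu>: "0 \<le> \<mu>" "\<mu> \<le> L"
    using assms(2) strong_convexity_le_smoothness[OF assms] by (simp_all add: strongly_convex_def)
  have "\<bar>V $ k\<bar> \<le> L * norm (y - x)" for k
  proof -
    obtain w where w: "itoh_abe_grad f y x $ k
        = (grad f w - \<mu> *\<^sub>R w) $ k + \<mu> / 2 * (y $ k + x $ k)" "norm (w - x) \<le> norm (y - x)"
      using itoh_abe_mean_value[OF assms(1)] by blast
    define D where "D = (grad f w - \<mu> *\<^sub>R w) - (grad f x - \<mu> *\<^sub>R x)"
    have "V $ k = D $ k + \<mu> * (y - x) $ k"
      by (simp add: V_def D_def w(1) field_simps)
    also have "\<bar>\<dots>\<bar> \<le> \<bar>D $ k\<bar> + \<mu> * \<bar>(y - x) $ k\<bar>"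
      using \<mu>(1) by (metis abs_mult abs_of_nonneg abs_triangle_ineq)
    also have "\<dots> \<le> norm D + \<mu> * norm (y - x)"
      by (intro add_mono mult_left_mono component_le_norm_cart \<mu>)
    also have "norm D \<le> (L - \<mu>) * norm (w - x)"
      unfolding D_def by (rule lipschitz_grad_minus_quadratic[OF assms])
    also have "\<dots> \<le> (L - \<mu>) * norm (y - x)" using \<mu> w(2) by (intro mult_left_mono) auto
    finally show ?thesis by (simp add: algebra_simps)
  qed
  then have "(V $ k)\<^sup>2 \<le> (L * norm (y - x))\<^sup>2" for k by (metis abs_ge_zero power2_abs power_mono)
  then have "(\<Sum>k\<in>UNIV. (V $ k)\<^sup>2) \<le> (\<Sum>k\<in>(UNIV::'n set). (L * norm (y - x))\<^sup>2)"
    by (intro sum_mono)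
  moreover have "(norm V)\<^sup>2 = (\<Sum>k\<in>UNIV. (V $ k)\<^sup>2)"
    unfolding power2_norm_eq_inner inner_vec_def by (simp add: power2_eq_square)
  ultimately show ?thesis by (simp add: V_def power_mult_distrib)
qed

text \<open>The discrete chain rule handles \<open>f y - f z\<close> and the tangent at
  \<open>z\<close> handles \<open>f z - f x\<close>. What remains is the error \<open>D\<close> of
  the discrete gradient paired with \<open>z - x = c - b\<close>.\<close>

lemma weak_discrete_gradient_itoh_abe:
  fixes f :: "real^'n::{finite,linorder} \<Rightarrow> real"
  assumes "f differentiable_on UNIV" "strongly_convex \<mu> f" "L_smooth L f" "\<mu> > 0"
  shows "weak_discrete_gradient f (itoh_abe_grad f)
    (real CARD('n) * L\<^sup>2 / \<mu> - \<mu> / 4) (\<mu> / 2) (- \<mu> / 4)"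
proof -
  have "\<mu> \<le> L" by (rule strong_convexity_le_smoothness[OF assms(1-3)])
  \<comment> \<open>With at least one coordinate and \<open>\<mu> \<le> L\<close>, this makes the
    first parameter nonnegative.\<close>
  have "\<mu> * \<mu> \<le> real CARD('n) * L\<^sup>2"
  proof -
    have "1 * (\<mu> * \<mu>) \<le> real CARD('n) * (L * L)"
      using \<open>\<mu> \<le> L\<close> assms(4) by (intro mult_mono) (auto simp: Suc_le_eq)
    then show ?thesis by (simp add: power2_eq_square)
  qed
  then have "\<mu> \<le> real CARD('n) * L\<^sup>2 / \<mu>" using assms(4) by (simp add: field_simps)
  then have \<alpha>: "0 \<le> real CARD('n) * L\<^sup>2 / \<mu> - \<mu> / 4" using assms(4) by linarith
  have bound: "f y - f x \<le> itoh_abe_grad f y z \<bullet> (y - x)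
      + (real CARD('n) * L\<^sup>2 / \<mu> - \<mu> / 4) * (norm (y - z))\<^sup>2
      - \<mu> / 2 * (norm (z - x))\<^sup>2 + \<mu> / 4 * (norm (y - x))\<^sup>2" for x y z
  proof -
    define G where "G = itoh_abe_grad f y z"
    define D where "D = grad f z - G"
    define b where "b = y - z"
    define c where "c = y - x"
    have "f y - f x \<le> G \<bullet> b + grad f z \<bullet> (z - x) - \<mu> / 2 * (norm (z - x))\<^sup>2"
      using strongly_convex_above_tangent[OF assms(1,2), of z x]
        itoh_abe_discrete_chain_rule[of f y z]
      by (simp add: G_def b_def inner_diff_right norm_minus_commute)
    moreover have "G \<bullet> b + grad f z \<bullet> (z - x) = G \<bullet> c + D \<bullet> (c - b)"
      by (simp add: D_def b_def c_def inner_diff)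
    moreover have "D \<bullet> (c - b) \<le> (real CARD('n) * L\<^sup>2 / \<mu> - \<mu> / 4) * (norm b)\<^sup>2 + \<mu> / 4 * (norm c)\<^sup>2"
    proof -
      have "norm (G - grad f z + (\<mu> / 2) *\<^sub>R b) = norm (D - (\<mu> / 2) *\<^sub>R b)"
        unfolding D_def by (subst norm_minus_cancel[symmetric]) (simp add: algebra_simps)
      then have "(norm (D - (\<mu> / 2) *\<^sub>R b))\<^sup>2 \<le> real CARD('n) * L\<^sup>2 * (norm b)\<^sup>2"
        using itoh_abe_defect[OF assms(1-3), of y z] by (simp add: G_def b_def)
      \<comment> \<open>Completing squares with \<mu>/2 times \<open>b\<close> and \<open>c\<close>,
        the difference of the two squares contains \<open>\<mu> * (D \<bullet> (c - b))\<close>; the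
        square with \<open>b\<close> is the defect already bounded, the one with \<open>c\<close> is
        dropped.\<close>
      moreover have "0 \<le> (norm (D - (\<mu> / 2) *\<^sub>R c))\<^sup>2" by simp
      moreover have "(norm (D - (\<mu> / 2) *\<^sub>R v))\<^sup>2 =
          (norm D)\<^sup>2 - \<mu> * (D \<bullet> v) + \<mu>\<^sup>2 / 4 * (norm v)\<^sup>2" for v
        by (simp only: power2_norm_eq_inner)
          (simp add: inner_diff inner_commute power2_eq_square)
      ultimately have "\<mu> * (D \<bullet> (c - b)) \<le>
          real CARD('n) * L\<^sup>2 * (norm b)\<^sup>2 - \<mu>\<^sup>2 / 4 * (norm b)\<^sup>2 + \<mu>\<^sup>2 / 4 * (norm c)\<^sup>2"
        by (simp add: inner_diff_right right_diff_distrib)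
      also have "\<dots> = \<mu> * ((real CARD('n) * L\<^sup>2 / \<mu> - \<mu> / 4) * (norm b)\<^sup>2 + \<mu> / 4 * (norm c)\<^sup>2)"
        using assms(4) by (simp add: power2_eq_square field_simps)
      finally show ?thesis using assms(4) by simp
    qed
    ultimately show ?thesis by (simp add: G_def b_def c_def)
  qed
  have "itoh_abe_grad f x x = grad f x" for x
  proof -
    have "(\<chi> i. if i < k then x $ i else x $ i) = x" for k by (simp add: vec_eq_iff)
    then show ?thesis
      by (simp add: itoh_abe_grad_def partial_deriv_eq_grad[OF assms(1)])
  qed
  then show ?thesis
    unfolding weak_discrete_gradient_def using bound \<alpha> assms(4) by simp
qed

theorem theorem2p3:
  fixes f :: "real^'n::{finite,linorder} \<Rightarrow> real" and \<mu> L :: real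
  assumes "\<mu> \<ge> 0"
    and "f differentiable_on UNIV"
    and "\<exists>x. \<forall>y. f x \<le> f y"
    and "strongly_convex \<mu> f"
  shows
    "(L_smooth L f \<longrightarrow>
        weak_discrete_gradient f (\<lambda>y x. grad f x) (L / 2) (\<mu> / 2) 0) \<and>
     weak_discrete_gradient f (\<lambda>y x. grad f y) 0 0 (\<mu> / 2) \<and>
     (L_smooth L f \<longrightarrow>
        weak_discrete_gradient f (\<lambda>y x. grad f ((1/2) *\<^sub>R (x + y)))
          ((L + \<mu>) / 8) (\<mu> / 4) (\<mu> / 4)) \<and>
     (L_smooth L f \<longrightarrow>
        weak_discrete_gradient f (avf_grad f) (L / 6 + \<mu> / 12) (\<mu> / 4) (\<mu> / 4)) \<and>
     (L_smooth L f \<and> \<mu> > 0 \<longrightarrow>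
        weak_discrete_gradient f (gonzalez_grad f)
          ((L + \<mu>) / 8 + (L - \<mu>)\<^sup>2 / (16 * \<mu>)) (\<mu> / 4) 0) \<and>
     (L_smooth L f \<and> \<mu> > 0 \<longrightarrow>
        weak_discrete_gradient f (itoh_abe_grad f)
          (real CARD('n) * L\<^sup>2 / \<mu> - \<mu> / 4) (\<mu> / 2) (- \<mu> / 4))"
  by (intro conjI impI weak_discrete_gradient_explicit weak_discrete_gradient_implicit
      weak_discrete_gradient_midpoint weak_discrete_gradient_avf
      weak_discrete_gradient_gonzalez weak_discrete_gradient_itoh_abe assms; (elim conjE)?; assumption)

end
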